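(* Assume that $V_k^\alpha>-\infty$ for all $k=0,\ldots,n$ and all $\alpha\in\mathcal{A}$. Then for every $\alpha\in\mathcal{A}$, $$V_n^\alpha=\hat g(\mathbb{P}_{X_n^\alpha}),\qquad V_k^\alpha=\inf_{\beta\in\mathcal{A}_k(\alpha)}\Big[\hat f_k(\mathbb{P}_{X_k^\beta},\tilde\beta_k)+V_{k+1}^\beta\Big],\quad k=0,\ldots,n-1.$$
   Context: Setting. $(E,|\cdot|)$ is a normed space and $(A,|\cdot|)$ is a normed space (typically a subset of $\mathbb{R}^m$), with $\sigma$-algebras $\mathcal{B}(E)$, $\mathcal{B}(A)$. $\mathcal{P}(E)$, $\mathcal{P}(A)$ are the sets of probability measures on $E$, $A$; $\|\mu\|_2^2:=\int|x|^2\mu(dx)$, and $\mathcal{P}_2(E)$ (resp. $\mathcal{P}_2(A)$) is the set of $\mu$ with $\|\mu\|_2<\infty$. On a probability space $(\Omega,\mathcal{F},\mathbb{P})$, $(\varepsilon_k)_{k\ge1}$ is an i.i.d. sequence of $\mathbb{R}^d$-valued random variables, independent of a square integrable $E$-valued random variable $\xi$. $\mathbb{P}_Y$ denotes the law of a random variable $Y$. The maps $F_{k+1}:E\times\mathcal{P}(E)\times A\times\mathcal{P}(A)\times\mathbb{R}^d\to E$, $k\in\mathbb{N}$, are measurable. Standing assumptions. For each $k\in\mathbb{N}$ there is a constant $C_{k,F}>0$ with $\mathbb{E}\big[|F_{k+1}(x,\mu,a,\lambda,\varepsilon_{k+1})|^2\big]\le C_{k,F}(1+|x|^2+|a|^2+\|\mu\|_2^2+\|\lambda\|_2^2)$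 for all $(x,\mu,a,\lambda)$. A horizon $n\ge1$ is fixed. The functions $f_k:E\times\mathcal{P}_2(E)\times A\times\mathcal{P}_2(A)\to\mathbb{R}$ ($k=0,\ldots,n-1$) and $g:E\times\mathcal{P}_2(E)\to\mathbb{R}$ are measurable with $|f_k(x,\mu,a,\lambda)|\le C_{k,f}(1+|x|^2+|a|^2+\|\mu\|_2^2+\|\lambda\|_2^2)$ and $|g(x,\mu)|\le C_g(1+|x|^2+\|\mu\|_2^2)$ for some positive constants. Controls. $A^E$ is the set of measurable functions $\tilde\alpha:E\to A$ with linear growth ($|\tilde\alpha(x)|\le C(1+|x|)$ for some $C$). $\mathcal{A}$ is the set of feedback controls, identified with sequences $\alpha=(\tilde\alpha_k)_{k\in\mathbb{N}}$ in $A^E$; the associated state process is $X_0^\alpha=\xi$, $X_{k+1}^\alpha=F_{k+1}(X_k^\alpha,\mathbb{P}_{X_k^\alpha},\alpha_k,\mathbb{P}_{\alpha_k},\varepsilon_{k+1})$ with $\alpha_k=\tilde\alpha_k(X_k^\alpha)$. Under the assumptions $\mathbb{P}_{X_k^\alpha}\in\mathcal{P}_2(E)$ for all $k$. For $\tilde\alpha\in A^E$ and $\mu\in\mathcal{P}_2(E)$, $\tilde\alpha\star\mu\in\mathcal{P}_2(A)$ is the image (pushforward) of $\mu$ by $\tilde\alpha$. Notation. $\hat f_k(\mu,\tilde\alpha):=\int_E f_k(x,\mu,\tilde\alpha(x),\tilde\alpha\star\mu)\,\mu(dx)$, $\hat g(\mu):=\int_E g(x,\mu)\,\mu(dx)$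 for $\mu\in\mathcal{P}_2(E)$, $\tilde\alpha\in A^E$. For $\alpha\in\mathcal{A}$ and $k=0,\ldots,n$, $\mathcal{A}_k(\alpha)=\{\beta\in\mathcal{A}:\beta_j=\alpha_j,\ j=0,\ldots,k-1\}$ (so $\mathcal{A}_0(\alpha)=\mathcal{A}$), and $$V_k^\alpha:=\inf_{\beta\in\mathcal{A}_k(\alpha)}\Big[\sum_{j=k}^{n-1}\hat f_j(\mathbb{P}_{X_j^\beta},\tilde\beta_j)+\hat g(\mathbb{P}_{X_n^\beta})\Big].$$ *)

theory Defs
  imports "HOL-Probability.Probability"
begin

definition sq_norm2 :: "'b::real_normed_vector measure \<Rightarrow> ennreal" where
  "sq_norm2 \<mu> = (\<integral>\<^sup>+ x. ennreal ((norm x)\<^sup>2) \<partial>\<mu>)"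

text \<open>The space of this measurable space is the set of probability measures on \<open>N\<close> with finite
  second moment; its \<open>\<sigma>\<close>-algebra is generated by the evaluations \<open>\<mu> \<mapsto> \<mu> B\<close>, \<open>B \<in> sets N\<close>.\<close>

definition P2 :: "'b::real_normed_vector measure \<Rightarrow> 'b measure measure" where
  "P2 N = restrict_space (prob_algebra N) {\<mu>. sq_norm2 \<mu> < \<infinity>}"

text \<open>The state space is the whole normed space \<open>'e\<close>. The action space \<open>A\<close> is an arbitrary subset of
  a normed space, with its trace Borel \<open>\<sigma>\<close>-algebra (\<open>A = UNIV\<close> is the case of a full normed space).
  The noise variables that matter are \<open>\<epsilon> 1, \<epsilon> 2, \<dots>\<close>, and the transition maps are
  \<open>F 1, F 2, \<dots>\<close>; the values at index 0 are irrelevant. The growth bounds are stated in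
  \<^typ>\<open>ennreal\<close> because in the bound for \<open>F\<close> the measures may have infinite second moment.\<close>

locale mckean_vlasov = prob_space M
  for M :: "'w measure" +
  fixes \<xi> :: "'w \<Rightarrow> 'e::real_normed_vector"
    and \<epsilon> :: "nat \<Rightarrow> 'w \<Rightarrow> real ^ 'd"
    and A :: "'a::real_normed_vector set"
    and F :: "nat \<Rightarrow> 'e \<Rightarrow> 'e measure \<Rightarrow> 'a \<Rightarrow> 'a measure \<Rightarrow> real ^ 'd \<Rightarrow> 'e"
    and n :: nat
    and f :: "nat \<Rightarrow> 'e \<Rightarrow> 'e measure \<Rightarrow> 'a \<Rightarrow> 'a measure \<Rightarrow> real"
    and g :: "'e \<Rightarrow> 'e measure \<Rightarrow> real"
  assumes xi_measurable: "random_variable borel \<xi>"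
    and xi_square_integrable: "integrable M (\<lambda>\<omega>. (norm (\<xi> \<omega>))\<^sup>2)"
    and noise_indep: "indep_vars (\<lambda>_. borel) \<epsilon> {1..}"
    and noise_ident: "\<And>k. 1 \<le> k \<Longrightarrow> distr M borel (\<epsilon> k) = distr M borel (\<epsilon> 1)"
    and xi_noise_indep:
      "indep_set (sets (vimage_algebra (space M) \<xi> borel))
        (sets (vimage_algebra (space M) (\<lambda>\<omega>. \<lambda>k\<in>{1..}. \<epsilon> k \<omega>) (\<Pi>\<^sub>M k\<in>{1..}. borel)))"
    and F_measurable:
      "\<And>k. (\<lambda>(x, \<mu>, a, \<nu>, e). F (Suc k) x \<mu> a \<nu> e)
        \<in> borel \<Otimes>\<^sub>M prob_algebra borel \<Otimes>\<^sub>M restrict_space borel A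
          \<Otimes>\<^sub>M prob_algebra (restrict_space borel A) \<Otimes>\<^sub>M borel \<rightarrow>\<^sub>M borel"
    and F_growth:
      "\<And>k. \<exists>C>0. \<forall>x. \<forall>\<mu>\<in>space (prob_algebra borel). \<forall>a\<in>A.
        \<forall>\<nu>\<in>space (prob_algebra (restrict_space borel A)).
          (\<integral>\<^sup>+ \<omega>. ennreal ((norm (F (Suc k) x \<mu> a \<nu> (\<epsilon> (Suc k) \<omega>)))\<^sup>2) \<partial>M)
          \<le> ennreal C * (1 + ennreal ((norm x)\<^sup>2) + ennreal ((norm a)\<^sup>2)
              + sq_norm2 \<mu> + sq_norm2 \<nu>)"
    and horizon: "1 \<le> n"
    and f_measurable:
      "\<And>k. k < n \<Longrightarrow> (\<lambda>(x, \<mu>, a, \<nu>). f k x \<mu> a \<nu>)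
        \<in> borel \<Otimes>\<^sub>M P2 borel \<Otimes>\<^sub>M restrict_space borel A \<Otimes>\<^sub>M P2 (restrict_space borel A)
          \<rightarrow>\<^sub>M borel"
    and f_growth:
      "\<And>k. k < n \<Longrightarrow> \<exists>C>0. \<forall>x. \<forall>\<mu>\<in>space (P2 borel). \<forall>a\<in>A.
        \<forall>\<nu>\<in>space (P2 (restrict_space borel A)).
          ennreal \<bar>f k x \<mu> a \<nu>\<bar>
          \<le> ennreal C * (1 + ennreal ((norm x)\<^sup>2) + ennreal ((norm a)\<^sup>2)
              + sq_norm2 \<mu> + sq_norm2 \<nu>)"
    and g_measurable: "(\<lambda>(x, \<mu>). g x \<mu>) \<in> borel \<Otimes>\<^sub>M P2 borel \<rightarrow>\<^sub>M borel"
    and g_growth: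
      "\<exists>C>0. \<forall>x. \<forall>\<mu>\<in>space (P2 borel).
        ennreal \<bar>g x \<mu>\<bar> \<le> ennreal C * (1 + ennreal ((norm x)\<^sup>2) + sq_norm2 \<mu>)"
begin

definition feedback :: "('e \<Rightarrow> 'a) set" where
  "feedback = {a \<in> borel \<rightarrow>\<^sub>M restrict_space borel A. \<exists>C. \<forall>x. norm (a x) \<le> C * (1 + norm x)}"

definition controls :: "(nat \<Rightarrow> 'e \<Rightarrow> 'a) set" where
  "controls = {\<alpha>. \<forall>k. \<alpha> k \<in> feedback}"

definition controls_from :: "nat \<Rightarrow> (nat \<Rightarrow> 'e \<Rightarrow> 'a) \<Rightarrow> (nat \<Rightarrow> 'e \<Rightarrow> 'a) set" where
  "controls_from k \<alpha> = {\<beta> \<in> controls. \<forall>j<k. \<beta> j = \<alpha> j}"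

primrec X :: "(nat \<Rightarrow> 'e \<Rightarrow> 'a) \<Rightarrow> nat \<Rightarrow> 'w \<Rightarrow> 'e" where
  "X \<alpha> 0 = \<xi>"
| "X \<alpha> (Suc k) = (\<lambda>\<omega>.
    F (Suc k) (X \<alpha> k \<omega>) (distr M borel (X \<alpha> k))
      (\<alpha> k (X \<alpha> k \<omega>)) (distr M (restrict_space borel A) (\<lambda>\<omega>'. \<alpha> k (X \<alpha> k \<omega>')))
      (\<epsilon> (Suc k) \<omega>))"

definition law :: "(nat \<Rightarrow> 'e \<Rightarrow> 'a) \<Rightarrow> nat \<Rightarrow> 'e measure" where
  "law \<alpha> k = distr M borel (X \<alpha> k)"

definition fhat :: "nat \<Rightarrow> 'e measure \<Rightarrow> ('e \<Rightarrow> 'a) \<Rightarrow> real" where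
  "fhat k \<mu> a = (\<integral>x. f k x \<mu> (a x) (distr \<mu> (restrict_space borel A) a) \<partial>\<mu>)"

definition ghat :: "'e measure \<Rightarrow> real" where
  "ghat \<mu> = (\<integral>x. g x \<mu> \<partial>\<mu>)"

text \<open>The integrals \<open>fhat\<close> and \<open>ghat\<close> converge along controlled laws by the growth assumptions, so
  the costs are real; only the infimum has to be taken in the extended reals.\<close>

definition V :: "(nat \<Rightarrow> 'e \<Rightarrow> 'a) \<Rightarrow> nat \<Rightarrow> ereal" where
  "V \<alpha> k = (INF \<beta>\<in>controls_from k \<alpha>.
    ereal ((\<Sum>j\<in>{k..<n}. fhat j (law \<beta> j) (\<beta> j)) + ghat (law \<beta> n)))"

end

end

theory Submission
  imports Defs
begin

text \<open>The law at time \<open>k\<close> depends on a control only through its first \<open>k\<close> components. Hence the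
  running cost \<open>fhat k\<close> is constant over the controls that agree with a given \<open>\<beta>\<close> up to and
  including time \<open>k\<close>, and can be pulled out of the infimum that defines \<open>V \<beta> (Suc k)\<close>.\<close>

context mckean_vlasov
begin

lemma X_cong:
  assumes "\<And>j. j < k \<Longrightarrow> \<alpha> j = \<beta> j"
  shows "X \<alpha> k = X \<beta> k"
  using assms by (induction k) simp_all

lemma law_cong:
  assumes "\<And>j. j < k \<Longrightarrow> \<alpha> j = \<beta> j"
  shows "law \<alpha> k = law \<beta> k"
  unfolding law_def using X_cong[OF assms] by simp

lemma controls_from_refl: "\<alpha> \<in> controls \<Longrightarrow> \<alpha> \<in> controls_from k \<alpha>"
  by (simp add: controls_from_def)

text \<open>Lets a competitor for \<open>V \<beta> (Suc k)\<close> serve as a competitor for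
  \<open>V \<alpha> k\<close>.\<close>

lemma controls_from_Suc_trans:
  "\<beta> \<in> controls_from k \<alpha> \<Longrightarrow> \<gamma> \<in> controls_from (Suc k) \<beta> \<Longrightarrow> \<gamma> \<in> controls_from k \<alpha>"
  by (simp add: controls_from_def)

text \<open>Kept real-valued, so that splitting off the first running cost is plain real arithmetic;
  extended reals enter only with the infimum.\<close>

definition cost_to_go :: "(nat \<Rightarrow> 'e \<Rightarrow> 'a) \<Rightarrow> nat \<Rightarrow> real" where
  "cost_to_go \<beta> k = (\<Sum>j\<in>{k..<n}. fhat j (law \<beta> j) (\<beta> j)) + ghat (law \<beta> n)"

lemma V_eq_INF_cost: "V \<alpha> k = (INF \<beta>\<in>controls_from k \<alpha>. ereal (cost_to_go \<beta> k))"
  by (simp add: V_def cost_to_go_def)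

lemma cost_to_go_Suc:
  "k < n \<Longrightarrow> cost_to_go \<beta> k = fhat k (law \<beta> k) (\<beta> k) + cost_to_go \<beta> (Suc k)"
  by (simp add: cost_to_go_def sum.atLeast_Suc_lessThan)

lemma V_horizon:
  assumes "\<alpha> \<in> controls"
  shows "V \<alpha> n = ereal (ghat (law \<alpha> n))"
proof -
  have "cost_to_go \<beta> n = ghat (law \<alpha> n)" if "\<beta> \<in> controls_from n \<alpha>" for \<beta>
    using that law_cong[of n \<beta> \<alpha>] by (simp add: cost_to_go_def controls_from_def)
  then have "V \<alpha> n = (INF \<beta>\<in>controls_from n \<alpha>. ereal (ghat (law \<alpha> n)))"
    by (simp add: V_eq_INF_cost)
  \<comment> \<open>An infimum over the empty set would be \<infinity>; \<open>\<alpha>\<close>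
    itself makes the index set nonempty.\<close>
  also have "\<dots> = ereal (ghat (law \<alpha> n))"
    using controls_from_refl[OF assms, of n] by (intro cINF_const) auto
  finally show ?thesis .
qed

text \<open>The nested and the single infimum range over the same costs: a continuation of an
  admissible \<open>\<beta>\<close> is again admissible from time \<open>k\<close>, and each
  \<open>\<beta>\<close> continues itself.\<close>

lemma V_dynamic_programming:
  assumes "k < n"
  shows "V \<alpha> k = (INF \<beta>\<in>controls_from k \<alpha>. ereal (fhat k (law \<beta> k) (\<beta> k)) + V \<beta> (Suc k))"
proof (rule antisym)
  show "V \<alpha> k \<le> (INF \<beta>\<in>controls_from k \<alpha>. ereal (fhat k (law \<beta> k) (\<beta> k)) + V \<beta> (Suc k))"
  proof (rule INF_greatest)
    fix \<beta> assume \<beta>: "\<beta> \<in> controls_from k \<alpha>"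
    let ?c = "fhat k (law \<beta> k) (\<beta> k)"
    \<comment> \<open>Since \<open>?c\<close> is finite, it may change sides even if the values are
      infinite; what remains is a lower bound on the infimum \<open>V \<beta> (Suc k)\<close>
      alone.\<close>
    have "V \<alpha> k - ereal ?c \<le> V \<beta> (Suc k)"
      unfolding V_eq_INF_cost[of \<beta>]
    proof (rule INF_greatest)
      fix \<gamma> assume \<gamma>: "\<gamma> \<in> controls_from (Suc k) \<beta>"
      \<comment> \<open>The case \<open>j = k\<close> matters: the law at time \<open>k\<close> sees
        only indices below \<open>k\<close>, but the running cost also evaluates
        \<open>\<gamma> k\<close>.\<close>
      then have eq: "\<gamma> j = \<beta> j" if "j \<le> k" for j
        using that by (simp add: controls_from_def)
      have "law \<gamma> k = law \<beta> k"
        by (rule law_cong) (simp add: eq)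
      then have "cost_to_go \<gamma> k = ?c + cost_to_go \<gamma> (Suc k)"
        by (simp add: cost_to_go_Suc[OF assms] eq)
      moreover have "V \<alpha> k \<le> ereal (cost_to_go \<gamma> k)"
        unfolding V_eq_INF_cost by (rule INF_lower) (rule controls_from_Suc_trans[OF \<beta> \<gamma>])
      ultimately show "V \<alpha> k - ereal ?c \<le> ereal (cost_to_go \<gamma> (Suc k))"
        by (simp add: ereal_minus_le add.commute)
    qed
    then show "V \<alpha> k \<le> ereal ?c + V \<beta> (Suc k)"
      by (simp add: ereal_minus_le add.commute)
  qed
  show "(INF \<beta>\<in>controls_from k \<alpha>. ereal (fhat k (law \<beta> k) (\<beta> k)) + V \<beta> (Suc k)) \<le> V \<alpha> k"
    unfolding V_eq_INF_cost[of \<alpha>]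
  proof (rule INF_mono)
    fix \<beta> assume \<beta>: "\<beta> \<in> controls_from k \<alpha>"
    \<comment> \<open>The witness for \<open>INF_mono\<close> is \<open>\<beta>\<close> itself, a
      competitor in its own \<open>V \<beta> (Suc k)\<close>.\<close>
    then have "\<beta> \<in> controls_from (Suc k) \<beta>"
      by (intro controls_from_refl) (simp add: controls_from_def)
    then have "V \<beta> (Suc k) \<le> ereal (cost_to_go \<beta> (Suc k))"
      unfolding V_eq_INF_cost by (rule INF_lower)
    then have "ereal (fhat k (law \<beta> k) (\<beta> k)) + V \<beta> (Suc k) \<le> ereal (cost_to_go \<beta> k)"
      \<comment> \<open>The flipped rule splits \<open>ereal\<close> of the real sum, so that both
        sides share the left summand.\<close>
      using add_left_mono by (fastforce simp: cost_to_go_Suc[OF assms] simp flip: plus_ereal.simps(1))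
    with \<beta> show "\<exists>\<beta>'\<in>controls_from k \<alpha>.
        ereal (fhat k (law \<beta>' k) (\<beta>' k)) + V \<beta>' (Suc k) \<le> ereal (cost_to_go \<beta> k)"
      by blast
  qed
qed

end

theorem lemma3p1:
  fixes M :: "'w measure"
    and \<xi> :: "'w \<Rightarrow> 'e::real_normed_vector"
    and \<epsilon> :: "nat \<Rightarrow> 'w \<Rightarrow> real ^ 'd"
    and A :: "'a::real_normed_vector set"
    and F :: "nat \<Rightarrow> 'e \<Rightarrow> 'e measure \<Rightarrow> 'a \<Rightarrow> 'a measure \<Rightarrow> real ^ 'd \<Rightarrow> 'e"
    and n :: nat
    and f :: "nat \<Rightarrow> 'e \<Rightarrow> 'e measure \<Rightarrow> 'a \<Rightarrow> 'a measure \<Rightarrow> real"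
    and g :: "'e \<Rightarrow> 'e measure \<Rightarrow> real"
    and \<alpha> :: "nat \<Rightarrow> 'e \<Rightarrow> 'a"
  assumes "mckean_vlasov M \<xi> \<epsilon> A F n f g"
    and "\<forall>k\<le>n. \<forall>\<beta>\<in>mckean_vlasov.controls A. - \<infinity> < mckean_vlasov.V M \<xi> \<epsilon> A F n f g \<beta> k"
    and "\<alpha> \<in> mckean_vlasov.controls A"
  shows "mckean_vlasov.V M \<xi> \<epsilon> A F n f g \<alpha> n
      = ereal (mckean_vlasov.ghat g (mckean_vlasov.law M \<xi> \<epsilon> A F \<alpha> n))
    \<and> (\<forall>k<n. mckean_vlasov.V M \<xi> \<epsilon> A F n f g \<alpha> k
      = (INF \<beta>\<in>mckean_vlasov.controls_from A k \<alpha>.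
          ereal (mckean_vlasov.fhat A f k (mckean_vlasov.law M \<xi> \<epsilon> A F \<beta> k) (\<beta> k))
          + mckean_vlasov.V M \<xi> \<epsilon> A F n f g \<beta> (Suc k)))"
proof -
  interpret mckean_vlasov M \<xi> \<epsilon> A F n f g
    by fact
  show ?thesis
    using V_horizon[OF assms(3)] V_dynamic_programming by blast
qed

end
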